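(* Let $\alpha>0$, $\beta>0$, let $n\ge 1$ be an integer, and let $R_0,R_1,\dots,R_n$ be the first $n+1$ upper record values from the Weibull distribution $W(\alpha,\beta)$. Then: (i) $U=2\beta\sum_{i=0}^n \log\left(\frac{R_n}{R_i}\right)$ has a chi-square distribution with $2n$ degrees of freedom. (ii) $V=2\left(\frac{R_n}{\alpha}\right)^{\beta}$ has a chi-square distribution with $2n+2$ degrees of freedom. (iii) $U$ and $V$ are independent.
   Context: The Weibull distribution $W(\alpha,\beta)$ with parameters $\alpha,\beta>0$ has cumulative distribution function $F(x)=1-e^{-(x/\alpha)^\beta}$ for $x>0$. Upper record values: let $X_1,X_2,\dots$ be an infinite sequence of independent identically distributed random variables with the given distribution. Set $T_0=1$ and, for $k\ge 1$, $T_k=\min\{j: X_j>X_{T_{k-1}}\}$ (almost surely finite here). The upper record values are $R_k=X_{T_k}$, $k=0,1,2,\dots$. *)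

theory Defs
  imports "HOL-Probability.Probability"
begin

definition weibull_cdf :: "real \<Rightarrow> real \<Rightarrow> real \<Rightarrow> real" where
  "weibull_cdf \<alpha> \<beta> x = (if x > 0 then 1 - exp (- ((x / \<alpha>) powr \<beta>)) else 0)"

definition chi_square_density :: "nat \<Rightarrow> real \<Rightarrow> real" where
  "chi_square_density k x =
     (if x > 0
      then x powr (real k / 2 - 1) * exp (- x / 2) / (2 powr (real k / 2) * Gamma (real k / 2))
      else 0)"

text \<open>
  Observations are indexed from \<open>0\<close>: \<open>X j\<close> is the \<open>(j+1)\<close>-st observation, so the first
  record time is \<open>0\<close>. If no observation exceeds the current record (a null event for iid
  observations with a continuous distribution), \<open>LEAST\<close> returns an unspecified index
  that does not depend on \<open>\<omega>\<close>.
\<close>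

fun record_time :: "(nat \<Rightarrow> 'a \<Rightarrow> real) \<Rightarrow> nat \<Rightarrow> 'a \<Rightarrow> nat" where
  "record_time X 0 \<omega> = 0"
| "record_time X (Suc k) \<omega> = (LEAST j. X j \<omega> > X (record_time X k \<omega>) \<omega>)"

definition record_value :: "(nat \<Rightarrow> 'a \<Rightarrow> real) \<Rightarrow> nat \<Rightarrow> 'a \<Rightarrow> real" where
  "record_value X k \<omega> = X (record_time X k \<omega>) \<omega>"

end

theory Submission
  imports Defs
begin

text \<open>
  The variables \<open>(X j / \<alpha>) powr \<beta>\<close> are independent standard exponentials with the same record
  times as \<open>X\<close>, so with their record values \<open>W\<^sub>0 < W\<^sub>1 < \<dots>\<close> almost surely \<open>V = 2 W\<^sub>n\<close> and
  \<open>U = 2 S\<^sub>n\<close>, where \<open>S\<^sub>k = (\<Sum>i<k. (i + 1) ln (W\<^sub>i\<^sub>+\<^sub>1 / W\<^sub>i))\<close>. The pair \<open>(S\<^sub>k, W\<^sub>k)\<close> is a Markov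
  chain in which \<open>W\<^sub>k\<^sub>+\<^sub>1 - W\<^sub>k\<close> is standard exponential. By induction on \<open>k\<close>, \<open>S\<^sub>k\<close> and \<open>W\<^sub>k\<close> are
  independent with Gamma laws of shape \<open>k\<close> and \<open>k + 1\<close>: given \<open>W\<^sub>k\<^sub>+\<^sub>1 = x\<close>, the density of \<open>W\<^sub>k\<close> is
  proportional to \<open>w\<^sup>k\<close> on \<open>(0, x)\<close>, so \<open>(k + 1) ln (x / W\<^sub>k)\<close> is standard exponential whatever \<open>x\<close>.
\<close>

section \<open>Record quantities of a sequence at a fixed time\<close>

primrec running_max :: "(nat \<Rightarrow> real) \<Rightarrow> nat \<Rightarrow> real" where
  "running_max x 0 = x 0"
| "running_max x (Suc j) = max (running_max x j) (x (Suc j))"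

primrec record_count :: "(nat \<Rightarrow> real) \<Rightarrow> nat \<Rightarrow> nat" where
  "record_count x 0 = 0"
| "record_count x (Suc j) =
    (if x (Suc j) > running_max x j then Suc (record_count x j) else record_count x j)"

text \<open>Record times are random, so the chain is also described at a fixed time
  \<open>j\<close>, through functions of \<open>x 0\<close>, ..., \<open>x j\<close> alone, to which
  the next observation is independent. The factor is the weight that \<open>log_spacing\<close>
  gives to the step from record number \<open>record_count x j\<close> to its successor.\<close>

primrec running_spacing :: "(nat \<Rightarrow> real) \<Rightarrow> nat \<Rightarrow> real" where
  "running_spacing x 0 = 0"
| "running_spacing x (Suc j) =
    (if x (Suc j) > running_max x j
     then running_spacing x j + real (Suc (record_count x j)) * ln (x (Suc j) / running_max x j)
     else running_spacing x j)"

definition log_spacing :: "(nat \<Rightarrow> real) \<Rightarrow> nat \<Rightarrow> real" where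
  "log_spacing w k = (\<Sum>i<k. real (Suc i) * ln (w (Suc i) / w i))"

lemma log_spacing_0 [simp]: "log_spacing w 0 = 0"
  by (simp add: log_spacing_def)

lemma log_spacing_Suc [simp]:
  "log_spacing w (Suc k) = log_spacing w k + real (Suc k) * ln (w (Suc k) / w k)"
  by (simp add: log_spacing_def)

text \<open>Summation by parts: ln (w k / w i) telescopes into consecutive log ratios, and the ratio
  of terms i and i + 1 occurs in the i + 1 telescoping sums that start at or below i. Positivity
  lets the logarithms split.\<close>

lemma log_spacing_eq_sum:
  assumes "\<And>i. i \<le> k \<Longrightarrow> w i > 0"
  shows "log_spacing w k = (\<Sum>i=0..k. ln (w k / w i))"
  using assms
proof (induction k)
  case (Suc k)
  have "(\<Sum>i=0..Suc k. ln (w (Suc k) / w i)) = (\<Sum>i=0..k. ln (w (Suc k) / w i))"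
    using Suc.prems[of "Suc k"] by simp
  also have "\<dots> = (\<Sum>i=0..k. ln (w (Suc k) / w k) + ln (w k / w i))"
    using less_imp_neq[OF Suc.prems] by (intro sum.cong) (auto simp: ln_div)
  also have "\<dots> = real (Suc k) * ln (w (Suc k) / w k) + (\<Sum>i=0..k. ln (w k / w i))"
    by (simp add: sum.distrib)
  finally show ?case using Suc by simp
qed simp

text \<open>This presents the past at time \<open>j\<close> as a function of a block of
  observations, the form in which independence of disjoint blocks applies.\<close>

lemma running_restrict:
  assumes "i \<le> j"
  shows "running_max (restrict x {..j}) i = running_max x i"
    and "record_count (restrict x {..j}) i = record_count x i"
    and "running_spacing (restrict x {..j}) i = running_spacing x i"
  using assms by (induction i) auto

text \<open>Only coordinates up to \<open>j\<close> are assumed measurable, so the result serves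
  both on the product space over \<open>{..j}\<close> and on the underlying probability
  space.\<close>

lemma measurable_running:
  assumes [measurable]: "\<And>i. i \<le> j \<Longrightarrow> (\<lambda>\<omega>. x \<omega> i) \<in> borel_measurable M"
  shows "(\<lambda>\<omega>. running_max (x \<omega>) j) \<in> borel_measurable M"
    and "(\<lambda>\<omega>. record_count (x \<omega>) j) \<in> measurable M (count_space UNIV)"
    and "(\<lambda>\<omega>. running_spacing (x \<omega>) j) \<in> borel_measurable M"
proof -
  have "(\<lambda>\<omega>. running_max (x \<omega>) i) \<in> borel_measurable M \<and>
    (\<lambda>\<omega>. record_count (x \<omega>) i) \<in> measurable M (count_space UNIV) \<and>
    (\<lambda>\<omega>. running_spacing (x \<omega>) i) \<in> borel_measurable M" if "i \<le> j" for i
    using that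
  proof (induction i)
    case (Suc i)
    then have [measurable]: "(\<lambda>\<omega>. running_max (x \<omega>) i) \<in> borel_measurable M"
      "(\<lambda>\<omega>. record_count (x \<omega>) i) \<in> measurable M (count_space UNIV)"
      "(\<lambda>\<omega>. running_spacing (x \<omega>) i) \<in> borel_measurable M"
      "(\<lambda>\<omega>. x \<omega> (Suc i)) \<in> borel_measurable M"
      by auto
    show ?case by simp
  qed simp
  from this[of j] show "(\<lambda>\<omega>. running_max (x \<omega>) j) \<in> borel_measurable M"
    and "(\<lambda>\<omega>. record_count (x \<omega>) j) \<in> measurable M (count_space UNIV)"
    and "(\<lambda>\<omega>. running_spacing (x \<omega>) j) \<in> borel_measurable M"
    by auto
qed

lemma measurable_record_time [measurable]:
  assumes [measurable]: "\<And>j. X j \<in> borel_measurable M"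
  shows "record_time X k \<in> measurable M (count_space UNIV)"
proof (induction k)
  case (Suc k)
  then have [measurable]: "record_time X k \<in> measurable M (count_space UNIV)" .
  show ?case unfolding record_time.simps(2)[abs_def] by measurable
qed (simp add: record_time.simps(1)[abs_def])

lemma measurable_record_value [measurable]:
  assumes [measurable]: "\<And>j. X j \<in> borel_measurable M"
  shows "record_value X k \<in> borel_measurable M"
  unfolding record_value_def[abs_def] by measurable

section \<open>Pathwise structure of the records of a sequence unbounded above\<close>

context
  fixes X :: "nat \<Rightarrow> 'a \<Rightarrow> real" and \<omega> :: 'a
  assumes unbounded: "\<And>c. \<exists>j. X j \<omega> > c"
begin

text \<open>Unboundedness ensures that each \<open>LEAST\<close> in \<open>record_time\<close> is
  attained, so its defining property may be used.\<close>

lemma record_value_less_Suc: "record_value X k \<omega> < record_value X (Suc k) \<omega>"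
  using LeastI_ex[OF unbounded] by (simp add: record_value_def)

lemma le_record_value:
  assumes "j < record_time X (Suc k) \<omega>"
  shows "X j \<omega> \<le> record_value X k \<omega>"
  using not_less_Least[OF assms[simplified]] by (simp add: record_value_def)

text \<open>The minimum defining a record time ranges over all indices, not only over later ones.
  Earlier indices are excluded because an observation before record time \<open>k\<close> is at most
  record value \<open>k - 1\<close> (for \<open>k\<close> positive), hence below record value
  \<open>k\<close>.\<close>

lemma record_time_less_Suc: "record_time X k \<omega> < record_time X (Suc k) \<omega>"
proof (cases k)
  case 0
  show ?thesis
    using record_value_less_Suc[of 0]
    by (cases "record_time X (Suc 0) \<omega>") (auto simp: 0 record_value_def simp del: record_time.simps(2))
next
  case (Suc k')
  have "\<not> record_time X (Suc k) \<omega> < record_time X k \<omega>"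
    using le_record_value[of "record_time X (Suc k) \<omega>" k'] record_value_less_Suc[of k]
      record_value_less_Suc[of k']
    unfolding Suc by (auto simp: record_value_def simp del: record_time.simps(2))
  moreover have "record_time X (Suc k) \<omega> \<noteq> record_time X k \<omega>"
    using record_value_less_Suc[of k] unfolding record_value_def by force
  ultimately show ?thesis by linarith
qed

lemma strict_mono_record_time: "strict_mono (\<lambda>k. record_time X k \<omega>)"
  using record_time_less_Suc by (rule strict_monoI_Suc)

text \<open>Induction on \<open>j\<close>: either \<open>Suc j\<close> is the next record time and
  all quantities advance together, or observation \<open>Suc j\<close> does not exceed the current
  record and nothing changes.\<close>

lemma running_eq_record:
  defines "x \<equiv> \<lambda>i. X i \<omega>"
  shows "record_time X (record_count x j) \<omega> \<le> j"
    and "j < record_time X (Suc (record_count x j)) \<omega>"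
    and "running_max x j = record_value X (record_count x j) \<omega>"
    and "running_spacing x j = log_spacing (\<lambda>i. record_value X i \<omega>) (record_count x j)"
proof -
  have "record_time X (record_count x j) \<omega> \<le> j \<and> j < record_time X (Suc (record_count x j)) \<omega> \<and>
    running_max x j = record_value X (record_count x j) \<omega> \<and>
    running_spacing x j = log_spacing (\<lambda>i. record_value X i \<omega>) (record_count x j)"
  proof (induction j)
    case 0
    show ?case using record_time_less_Suc[of 0]
      by (auto simp: record_value_def x_def simp del: record_time.simps(2))
  next
    case (Suc j)
    define k where "k = record_count x j"
    note IH = Suc.IH[folded k_def]
    show ?case
    proof (cases "Suc j = record_time X (Suc k) \<omega>")
      case True
      then have xj: "x (Suc j) = record_value X (Suc k) \<omega>" by (simp add: record_value_def x_def)
      then have gt: "x (Suc j) > running_max x j" using IH record_value_less_Suc[of k] by simp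
      then have "record_count x (Suc j) = Suc k"
        and "running_max x (Suc j) = record_value X (Suc k) \<omega>"
        and "running_spacing x (Suc j) = log_spacing (\<lambda>i. record_value X i \<omega>) (Suc k)"
        using IH xj by (simp_all add: k_def[symmetric] max_def)
      then show ?thesis using True record_time_less_Suc[of "Suc k"] by (metis order_refl)
    next
      case False
      then have "Suc j < record_time X (Suc k) \<omega>" using IH by linarith
      moreover from le_record_value[OF this] IH have "\<not> x (Suc j) > running_max x j"
        by (simp add: x_def)
      ultimately show ?thesis using IH by (simp add: k_def[symmetric] max_def del: record_time.simps(2))
    qed
  qed
  then show "record_time X (record_count x j) \<omega> \<le> j"
    and "j < record_time X (Suc (record_count x j)) \<omega>"
    and "running_max x j = record_value X (record_count x j) \<omega>"
    and "running_spacing x j = log_spacing (\<lambda>i. record_value X i \<omega>) (record_count x j)"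
    by auto
qed

text \<open>The left side involves only the past up to \<open>j\<close> and the next observation, so
  the random record time is expressed by events to which independence applies. For the converse,
  strict monotonicity of the record times leaves \<open>k\<close> as the only possible count at time
  \<open>j\<close>.\<close>

lemma record_occurs_iff:
  defines "x \<equiv> \<lambda>i. X i \<omega>"
  shows "record_count x j = k \<and> x (Suc j) > running_max x j \<longleftrightarrow> Suc j = record_time X (Suc k) \<omega>"
proof
  assume *: "record_count x j = k \<and> x (Suc j) > running_max x j"
  then have "j < record_time X (Suc k) \<omega>" "x (Suc j) > record_value X k \<omega>"
    using running_eq_record(2,3)[of j, folded x_def] by auto
  then show "Suc j = record_time X (Suc k) \<omega>"
    using le_record_value[of "Suc j" k] unfolding x_def by (metis Suc_lessI not_less)
next
  assume *: "Suc j = record_time X (Suc k) \<omega>"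
  define k' where "k' = record_count x j"
  have "record_time X k' \<omega> < record_time X (Suc k) \<omega>" "record_time X k \<omega> < record_time X (Suc k') \<omega>"
    using running_eq_record(1,2)[of j, folded x_def k'_def] * record_time_less_Suc[of k] by linarith+
  then have "k' < Suc k" "k < Suc k'"
    using strict_mono_less[OF strict_mono_record_time] by blast+
  then have "k' = k" by simp
  moreover have "x (Suc j) = record_value X (Suc k) \<omega>" by (simp add: record_value_def x_def *)
  ultimately show "record_count x j = k \<and> x (Suc j) > running_max x j"
    using running_eq_record(3)[of j, folded x_def] record_value_less_Suc[of k] k'_def by simp
qed

text \<open>Only the \<open>j\<close> just before record time \<open>Suc k\<close> can contribute.
  The random index is thus traded for a sum over fixed times, which may be exchanged with the
  expectation.\<close>

lemma suminf_next_record: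
  fixes G :: "real \<Rightarrow> real \<Rightarrow> real \<Rightarrow> ennreal"
  defines "x \<equiv> \<lambda>i. X i \<omega>"
  shows "(\<Sum>j. if record_count x j = k \<and> x (Suc j) > running_max x j
      then G (running_spacing x j) (running_max x j) (x (Suc j)) else 0) =
    G (log_spacing (\<lambda>i. record_value X i \<omega>) k) (record_value X k \<omega>) (record_value X (Suc k) \<omega>)"
proof -
  obtain a where a: "Suc a = record_time X (Suc k) \<omega>"
    using record_time_less_Suc[of k] by (metis not_less0 not0_implies_Suc)
  have iff: "record_count x j = k \<and> x (Suc j) > running_max x j \<longleftrightarrow> Suc j = record_time X (Suc k) \<omega>"
    for j
    unfolding x_def by (rule record_occurs_iff)
  have "record_count x a = k" "x (Suc a) = record_value X (Suc k) \<omega>"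
    using iff[of a] a by (auto simp: x_def record_value_def simp del: record_time.simps(2))
  then have "(if record_count x j = k \<and> x (Suc j) > running_max x j
      then G (running_spacing x j) (running_max x j) (x (Suc j)) else 0) =
    (if j \<in> {a} then G (log_spacing (\<lambda>i. record_value X i \<omega>) k) (record_value X k \<omega>) (record_value X (Suc k) \<omega>) else 0)"
    for j
    using iff[of j] a running_eq_record(3,4)[of a, folded x_def] record_value_less_Suc[of k]
    by (cases "j = a") auto
  then show ?thesis
    by (simp only:) (subst suminf_finite[of "{a}"], auto)
qed

end

section \<open>The Markov property of the record chain\<close>

lemma measurable_emeasure_greaterThan:
  fixes \<nu> :: "real measure"
  assumes "prob_space \<nu>" and [measurable_cong]: "sets \<nu> = sets borel"
  shows "(\<lambda>w. emeasure \<nu> {w<..}) \<in> borel_measurable borel"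
proof -
  interpret prob_space \<nu> by fact
  have "(\<lambda>w. \<integral>\<^sup>+x. (of_bool (x > w) :: ennreal) \<partial>\<nu>) \<in> borel_measurable borel" by measurable
  moreover have "(\<integral>\<^sup>+x. of_bool (x > w) \<partial>\<nu>) = emeasure \<nu> {w<..}" for w
    using assms(2) nn_integral_indicator[of "{w<..}" \<nu>] by (simp add: indicator_def)
  ultimately show ?thesis by simp
qed

context prob_space
begin

text \<open>The past is a function of the observations up to \<open>j\<close>, which are independent
  of observation \<open>Suc j\<close>; their joint law is a product and the integral can be
  iterated.\<close>

lemma nn_integral_past_next:
  fixes X :: "nat \<Rightarrow> 'a \<Rightarrow> real" and H :: "nat \<times> real \<times> real \<Rightarrow> real \<Rightarrow> ennreal"
  assumes indep: "indep_vars (\<lambda>_. borel) X UNIV"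
    and H [measurable]: "case_prod H \<in> borel_measurable ((count_space UNIV \<Otimes>\<^sub>M borel \<Otimes>\<^sub>M borel) \<Otimes>\<^sub>M borel)"
  defines "past \<equiv> \<lambda>j x. (record_count x j, running_spacing x j, running_max x j)"
  shows "(\<integral>\<^sup>+\<omega>. H (past j (\<lambda>i. X i \<omega>)) (X (Suc j) \<omega>) \<partial>M) =
    (\<integral>\<^sup>+\<omega>. \<integral>\<^sup>+x. H (past j (\<lambda>i. X i \<omega>)) x \<partial>distr M borel (X (Suc j)) \<partial>M)"
proof -
  have [measurable]: "X i \<in> borel_measurable M" for i
    using indep by (auto simp: indep_vars_def)
  let ?A = "PiM {..j} (\<lambda>_. borel) :: (nat \<Rightarrow> real) measure"
  \<comment> \<open>Independence of blocks yields restricted sequences, so the single next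
    observation is also carried as a sequence, over a one-point index set.\<close>
  let ?B = "PiM {Suc j} (\<lambda>_. borel) :: (nat \<Rightarrow> real) measure"
  let ?XA = "\<lambda>\<omega>. restrict (\<lambda>i. X i \<omega>) {..j}" and ?XB = "\<lambda>\<omega>. restrict (\<lambda>i. X i \<omega>) {Suc j}"
  have comp: "(\<lambda>x. x i) \<in> borel_measurable ?A" if "i \<le> j" for i
    using that by (intro measurable_component_singleton) simp
  have past [measurable]: "past j \<in> measurable ?A (count_space UNIV \<Otimes>\<^sub>M borel \<Otimes>\<^sub>M borel)"
    unfolding past_def
    using measurable_running[of j "\<lambda>x. x", OF comp] by (intro measurable_Pair) auto
  have past_restrict: "past j (restrict x {..j}) = past j x" for x
    by (simp add: past_def running_restrict)
  have ind: "indep_var ?A ?XA ?B ?XB"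
    by (rule indep_var_restrict[OF indep]) auto
  interpret B: prob_space "distr M ?B ?XB" by (rule prob_space_distr) measurable
  have HB: "(\<lambda>(x, y). H (past j x) (y (Suc j))) \<in> borel_measurable (?A \<Otimes>\<^sub>M ?B)"
    by measurable
  have "(\<integral>\<^sup>+\<omega>. H (past j (\<lambda>i. X i \<omega>)) (X (Suc j) \<omega>) \<partial>M) =
      (\<integral>\<^sup>+p. (\<lambda>(x, y). H (past j x) (y (Suc j))) p \<partial>distr M (?A \<Otimes>\<^sub>M ?B) (\<lambda>\<omega>. (?XA \<omega>, ?XB \<omega>)))"
    using HB by (subst nn_integral_distr) (auto simp: past_restrict)
  also have "\<dots> = (\<integral>\<^sup>+p. (\<lambda>(x, y). H (past j x) (y (Suc j))) p \<partial>(distr M ?A ?XA \<Otimes>\<^sub>M distr M ?B ?XB))"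
    using ind unfolding indep_var_distribution_eq by simp
  also have "\<dots> = (\<integral>\<^sup>+x. \<integral>\<^sup>+y. H (past j x) (y (Suc j)) \<partial>distr M ?B ?XB \<partial>distr M ?A ?XA)"
    using HB by (subst B.nn_integral_fst[symmetric]) (auto cong: measurable_cong_sets)
  also have "\<dots> = (\<integral>\<^sup>+\<omega>. \<integral>\<^sup>+y. H (past j (\<lambda>i. X i \<omega>)) (y (Suc j)) \<partial>distr M ?B ?XB \<partial>M)"
    by (subst nn_integral_distr) (auto simp: past_restrict)
  also have "\<dots> = (\<integral>\<^sup>+\<omega>. \<integral>\<^sup>+x. H (past j (\<lambda>i. X i \<omega>)) x \<partial>distr M borel (X (Suc j)) \<partial>M)"
  proof (intro nn_integral_cong)
    fix \<omega>
    have [measurable]: "H p \<in> borel_measurable borel" for p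
      using measurable_Pair2[OF H, of p] by (simp add: space_pair_measure)
    show "(\<integral>\<^sup>+y. H (past j (\<lambda>i. X i \<omega>)) (y (Suc j)) \<partial>distr M ?B ?XB) =
        (\<integral>\<^sup>+x. H (past j (\<lambda>i. X i \<omega>)) x \<partial>distr M borel (X (Suc j)))"
      by (simp add: nn_integral_distr)
  qed
  finally show ?thesis .
qed

text \<open>For a natural bound m, the first N + 1 observations all stay at or below m with
  probability r^(N+1), where r < 1 because \<nu> charges the half-line above m. This tends to 0, and
  countably many bounds m suffice.\<close>

lemma AE_unbounded_iid:
  fixes X :: "nat \<Rightarrow> 'a \<Rightarrow> real"
  assumes indep: "indep_vars (\<lambda>_. borel) X UNIV"
    and distr: "\<And>j. distr M borel (X j) = \<nu>"
    and pos: "\<And>c. emeasure \<nu> {c<..} > 0"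
  shows "AE \<omega> in M. \<forall>c. \<exists>j. X j \<omega> > c"
proof -
  have [measurable]: "X j \<in> borel_measurable M" for j
    using indep by (auto simp: indep_vars_def)
  have "AE \<omega> in M. \<exists>j. X j \<omega> > real m" for m
  proof -
    define r where "r = measure \<nu> {..real m}"
    have prob: "prob (X j -` {..real m} \<inter> space M) = r" for j
      unfolding r_def distr[of j, symmetric] by (simp add: measure_distr)
    interpret \<nu>: prob_space \<nu> unfolding distr[of 0, symmetric] by (rule prob_space_distr) simp
    have sets: "sets \<nu> = sets borel" and space: "space \<nu> = UNIV"
      unfolding distr[of 0, symmetric] by auto
    have "r = 1 - measure \<nu> {real m<..}"
      unfolding r_def using \<nu>.prob_compl[of "{real m<..}"]
      by (simp add: sets space Compl_eq_Diff_UNIV[symmetric])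
    also have "\<dots> < 1" using pos[of "real m"] by (simp add: \<nu>.emeasure_eq_measure)
    finally have "r < 1" .
    let ?E = "{\<omega> \<in> space M. \<forall>j. X j \<omega> \<le> real m}"
    have "prob ?E \<le> r ^ Suc N" for N
    proof -
      have "prob ?E \<le> prob (\<Inter>j\<in>{..N}. X j -` {..real m} \<inter> space M)"
        by (intro finite_measure_mono) auto
      also have "\<dots> = (\<Prod>j\<in>{..N}. prob (X j -` {..real m} \<inter> space M))"
        by (rule indep_varsD[OF indep]) auto
      finally show ?thesis by (simp add: prob)
    qed
    moreover have "(\<lambda>N. r ^ Suc N) \<longlonglongrightarrow> 0"
      using \<open>r < 1\<close> by (intro LIMSEQ_Suc LIMSEQ_power_zero) (simp add: r_def)
    ultimately have "prob ?E \<le> 0" by (intro LIMSEQ_le_const) auto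
    then have "emeasure M ?E = 0" by (simp add: emeasure_eq_measure measure_le_0_iff)
    then show ?thesis by (intro AE_I[of _ _ ?E]) (auto simp: not_less)
  qed
  then have "AE \<omega> in M. \<forall>m. \<exists>j. X j \<omega> > real m" by (simp add: AE_all_countable)
  then show ?thesis
    by eventually_elim (metis reals_Archimedean2 less_trans)
qed

text \<open>The record chain is Markov. Conditioning each new observation on the past turns the
  expectation of a function of two consecutive records into an expectation over the whole time
  the earlier record survives. Since the same identity for functions of the earlier record alone
  determines the mean survival time, that time never has to be computed.\<close>

lemma nn_integral_next_record:
  fixes X :: "nat \<Rightarrow> 'a \<Rightarrow> real" and G :: "real \<Rightarrow> real \<Rightarrow> real \<Rightarrow> ennreal"
  assumes indep: "indep_vars (\<lambda>_. borel) X UNIV"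
    and distr: "\<And>j. distr M borel (X j) = \<nu>"
    and pos: "\<And>c. emeasure \<nu> {c<..} > 0"
    and G: "(\<lambda>(s, w, x). G s w x) \<in> borel_measurable (borel \<Otimes>\<^sub>M borel \<Otimes>\<^sub>M borel)"
  defines "S \<equiv> \<lambda>k \<omega>. log_spacing (\<lambda>i. record_value X i \<omega>) k"
  shows "(\<integral>\<^sup>+\<omega>. G (S k \<omega>) (record_value X k \<omega>) (record_value X (Suc k) \<omega>) \<partial>M) =
    (\<integral>\<^sup>+\<omega>. (\<integral>\<^sup>+x. indicator {record_value X k \<omega><..} x * G (S k \<omega>) (record_value X k \<omega>) x \<partial>\<nu>) /
        emeasure \<nu> {record_value X k \<omega><..} \<partial>M)"
proof -
  have [measurable]: "X j \<in> borel_measurable M" for j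
    using indep by (auto simp: indep_vars_def)
  interpret \<nu>: prob_space \<nu> unfolding distr[of 0, symmetric] by (rule prob_space_distr) simp
  have sets_\<nu> [measurable_cong]: "sets \<nu> = sets borel" unfolding distr[of 0, symmetric] by simp
  have [measurable]: "(\<lambda>\<omega>. running_max (\<lambda>i. X i \<omega>) j) \<in> borel_measurable M"
    "(\<lambda>\<omega>. record_count (\<lambda>i. X i \<omega>) j) \<in> measurable M (count_space UNIV)"
    "(\<lambda>\<omega>. running_spacing (\<lambda>i. X i \<omega>) j) \<in> borel_measurable M" for j
    by (rule measurable_running, measurable)+
  \<comment> \<open>\<open>O' h\<close> is the expected sum of \<open>h\<close> over all times at
    which record number \<open>k\<close> is the current one, each such time counted once.\<close>
  define O' where "O' h = (\<Sum>j. \<integral>\<^sup>+\<omega>. (if record_count (\<lambda>i. X i \<omega>) j = k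
      then h (running_spacing (\<lambda>i. X i \<omega>) j) (running_max (\<lambda>i. X i \<omega>) j) else 0) \<partial>M)"
    for h :: "real \<Rightarrow> real \<Rightarrow> ennreal"
  have occupation: "(\<integral>\<^sup>+\<omega>. G (S k \<omega>) (record_value X k \<omega>) (record_value X (Suc k) \<omega>) \<partial>M) =
      O' (\<lambda>s w. \<integral>\<^sup>+x. indicator {w<..} x * G s w x \<partial>\<nu>)"
    if G: "(\<lambda>(s, w, x). G s w x) \<in> borel_measurable (borel \<Otimes>\<^sub>M borel \<Otimes>\<^sub>M borel)"
    for G :: "real \<Rightarrow> real \<Rightarrow> real \<Rightarrow> ennreal"
  proof -
    let ?past = "\<lambda>j \<omega>. (record_count (\<lambda>i. X i \<omega>) j, running_spacing (\<lambda>i. X i \<omega>) j, running_max (\<lambda>i. X i \<omega>) j)"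
    let ?N = "count_space UNIV \<Otimes>\<^sub>M borel \<Otimes>\<^sub>M borel :: (nat \<times> real \<times> real) measure"
    let ?H = "\<lambda>(c, s, w) x. if c = k then indicator {w<..} x * G s w x else 0"
    have [measurable]: "(\<lambda>p. G (fst (snd (fst p))) (snd (snd (fst p))) (snd p)) \<in> borel_measurable (?N \<Otimes>\<^sub>M borel)"
      using measurable_compose[OF _ G,
        of "\<lambda>p. (fst (snd (fst p)), snd (snd (fst p)), snd p)" "?N \<Otimes>\<^sub>M borel"]
      by simp
    have H [measurable]: "case_prod ?H \<in> borel_measurable (?N \<Otimes>\<^sub>M borel)"
      unfolding split_beta' indicator_def greaterThan_iff by measurable
    have "(\<integral>\<^sup>+\<omega>. G (S k \<omega>) (record_value X k \<omega>) (record_value X (Suc k) \<omega>) \<partial>M) =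
        (\<integral>\<^sup>+\<omega>. (\<Sum>j. ?H (?past j \<omega>) (X (Suc j) \<omega>)) \<partial>M)"
      \<comment> \<open>The pathwise identity holds only where the observations are unbounded, hence
        almost everywhere.\<close>
      using AE_unbounded_iid[OF indep distr pos]
    proof (intro nn_integral_cong_AE, eventually_elim)
      case (elim \<omega>)
      then show ?case
        unfolding S_def
        by (subst suminf_next_record[symmetric]) (auto intro!: suminf_cong)
    qed
    also have "\<dots> = (\<Sum>j. \<integral>\<^sup>+\<omega>. ?H (?past j \<omega>) (X (Suc j) \<omega>) \<partial>M)"
    proof (rule nn_integral_suminf)
      fix j
      have "(\<lambda>\<omega>. (?past j \<omega>, X (Suc j) \<omega>)) \<in> measurable M (?N \<Otimes>\<^sub>M borel)" by measurable
      from measurable_compose[OF this H]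
      show "(\<lambda>\<omega>. ?H (?past j \<omega>) (X (Suc j) \<omega>)) \<in> borel_measurable M" by simp
    qed
    also have "\<dots> = (\<Sum>j. \<integral>\<^sup>+\<omega>. \<integral>\<^sup>+x. ?H (?past j \<omega>) x \<partial>\<nu> \<partial>M)"
      unfolding nn_integral_past_next[OF indep H] distr ..
    also have "\<dots> = O' (\<lambda>s w. \<integral>\<^sup>+x. indicator {w<..} x * G s w x \<partial>\<nu>)"
      unfolding O'_def by (intro suminf_cong nn_integral_cong) (simp split: prod.split)
    finally show ?thesis .
  qed
  define h where "h s w = (\<integral>\<^sup>+x. indicator {w<..} x * G s w x \<partial>\<nu>)" for s w
  have h [measurable]: "(\<lambda>(s, w). h s w) \<in> borel_measurable (borel \<Otimes>\<^sub>M borel)"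
  proof -
    have [measurable]: "(\<lambda>p. G (fst (fst p)) (snd (fst p)) (snd p)) \<in> borel_measurable ((borel \<Otimes>\<^sub>M borel) \<Otimes>\<^sub>M \<nu>)"
      using measurable_compose[OF _ G,
        of "\<lambda>p. (fst (fst p), snd (fst p), snd p)" "(borel \<Otimes>\<^sub>M borel) \<Otimes>\<^sub>M \<nu>"]
      by simp
    show ?thesis unfolding h_def indicator_def greaterThan_iff by measurable
  qed
  note measurable_emeasure_greaterThan[OF \<nu>.prob_space_axioms sets_\<nu>, measurable]
  \<comment> \<open>This integrand is constant in x, so integrating it above w multiplies it by the
    tail mass and returns \<open>h s w\<close>. The cancellation is legitimate because the tail is
    positive by \<open>pos\<close> and finite.\<close>
  have cancel: "(\<integral>\<^sup>+x. indicator {w<..} x * (h s w / emeasure \<nu> {w<..}) \<partial>\<nu>) = h s w" for s w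
  proof -
    have "{w<..} \<in> sets \<nu>" by (simp add: sets_\<nu>)
    then have "(\<integral>\<^sup>+x. indicator {w<..} x * (h s w / emeasure \<nu> {w<..}) \<partial>\<nu>) =
        emeasure \<nu> {w<..} * (h s w / emeasure \<nu> {w<..})"
      by (subst nn_integral_multc) auto
    then show ?thesis
      using pos[of w] by (simp add: ennreal_times_divide mult_divide_eq_ennreal mult.commute)
  qed
  have "(\<lambda>(s, w, x). h s w / emeasure \<nu> {w<..}) \<in> borel_measurable (borel \<Otimes>\<^sub>M borel \<Otimes>\<^sub>M borel)"
    by measurable
  \<comment> \<open>Both \<open>G\<close> and the normalised integrand
    \<open>h s w / emeasure \<nu> {w<..}\<close> lead to the same \<open>O' h\<close>, which is
    thereby eliminated.\<close>
  from occupation[OF this]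
  have "(\<integral>\<^sup>+\<omega>. h (S k \<omega>) (record_value X k \<omega>) / emeasure \<nu> {record_value X k \<omega><..} \<partial>M) = O' h"
    by (simp add: cancel)
  also have "\<dots> = (\<integral>\<^sup>+\<omega>. G (S k \<omega>) (record_value X k \<omega>) (record_value X (Suc k) \<omega>) \<partial>M)"
    unfolding h_def by (rule occupation[OF G, symmetric])
  finally show ?thesis unfolding h_def by simp
qed

end

section \<open>One step of the chain for Gamma laws\<close>

lemma nn_integral_power_kernel:
  fixes g :: "real \<Rightarrow> ennreal"
  assumes x: "x > 0" and [measurable]: "g \<in> borel_measurable borel"
  shows "(\<integral>\<^sup>+w. ennreal (indicator {0..<x} w * w ^ k / fact k) * g (real (Suc k) * ln (x / w)) \<partial>lborel) =
    ennreal (x ^ Suc k / fact (Suc k)) * (\<integral>\<^sup>+t. g t \<partial>density lborel (exponential_density 1))"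
proof -
  \<comment> \<open>The kernel w^k / k! on [0, x) has mass x^(k+1) / (k+1)!, and \<open>d\<close> is
    its normalisation. Under \<open>d\<close> the variable \<open>Z\<close> is standard exponential
    for every x, which makes the spacing independent of the new record.\<close>
  define d :: "real \<Rightarrow> real" where "d w = indicator {0..<x} w * (real (Suc k) * w ^ k / x ^ Suc k)" for w
  define Z where "Z w = real (Suc k) * ln (x / w)" for w
  have d_nonneg: "d w \<ge> 0" for w using x by (auto simp: d_def split: split_indicator)
  have [measurable]: "d \<in> borel_measurable borel" "Z \<in> borel_measurable borel"
    unfolding d_def[abs_def] Z_def[abs_def] by measurable
  define N where "N = density lborel (\<lambda>w. ennreal (d w))"
  have "distributed N lborel Z (exponential_density 1)"
  proof (rule exponential_distributedI)
    fix a :: real assume a: "0 \<le> a"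
    \<comment> \<open>This is the solution w of \<open>Z w = a\<close>. Since \<open>Z\<close>
      decreases on positive w, the event is an interval ending at x, of \<open>d\<close>-mass 1 - (c
      / x)^(k+1) = 1 - exp (- a).\<close>
    define c where "c = x * exp (- a / real (Suc k))"
    have c: "0 < c" "c \<le> x" using x a by (auto simp: c_def)
    have Z_le: "Z w \<le> a \<longleftrightarrow> c \<le> w" if "w > 0" for w
    proof -
      have "Z w \<le> a \<longleftrightarrow> ln (x / w) \<le> a / real (Suc k)"
        by (simp add: Z_def pos_le_divide_eq mult.commute)
      also have "\<dots> \<longleftrightarrow> x / w \<le> exp (a / real (Suc k))"
        using x that by (subst ln_le_cancel_iff[symmetric]) auto
      also have "\<dots> \<longleftrightarrow> c \<le> w"
        using that by (simp add: c_def exp_minus field_simps)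
      finally show ?thesis .
    qed
    have "emeasure N {w \<in> space N. Z w \<le> a} = (\<integral>\<^sup>+w. ennreal (d w) * indicator {w. Z w \<le> a} w \<partial>lborel)"
      unfolding N_def by (subst emeasure_density) auto
    also have "\<dots> = (\<integral>\<^sup>+w. ennreal (real (Suc k) * w ^ k / x ^ Suc k) * indicator {c..x} w \<partial>lborel)"
    proof (intro nn_integral_cong_AE)
      \<comment> \<open>The two integrands can differ at 0, where division by zero makes
        \<open>Z\<close> vanish, and at x, the open end of the support of \<open>d\<close>.\<close>
      show "AE w in lborel. ennreal (d w) * indicator {w. Z w \<le> a} w =
          ennreal (real (Suc k) * w ^ k / x ^ Suc k) * indicator {c..x} w"
        using AE_lborel_singleton[of "0::real"] AE_lborel_singleton[of x]
      proof eventually_elim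
        case (elim w)
        then show ?case
          using Z_le[of w] c by (cases "w > 0") (auto simp: d_def indicator_def)
      qed
    qed
    also have "\<dots> = ennreal ((x / x) ^ Suc k - (c / x) ^ Suc k)"
    proof (rule nn_integral_FTC_Icc[where F = "\<lambda>w. (w / x) ^ Suc k"])
      fix w
      have "((\<lambda>w. (w / x) ^ Suc k) has_real_derivative real (Suc k) * ((w / x) ^ k * (1 / x))) (at w)"
        using DERIV_power_Suc[OF DERIV_cdivide[OF DERIV_ident], where n = k] by (simp add: mult_ac)
      then show "((\<lambda>w. (w / x) ^ Suc k) has_real_derivative real (Suc k) * w ^ k / x ^ Suc k) (at w)"
        by (simp add: power_divide mult.commute)
      show "0 \<le> real (Suc k) * w ^ k / x ^ Suc k" if "w \<in> {c..x}"
        using that c x by simp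
    qed (use c in auto)
    also have "(c / x) ^ Suc k = exp (- a * 1)"
      using x by (simp add: c_def exp_of_nat_mult[symmetric] del: power_Suc of_nat_Suc)
    finally show "emeasure N {w \<in> space N. Z w \<le> a} = 1 - ennreal (exp (- a * 1))"
      using x by (simp add: ennreal_minus flip: ennreal_1)
  qed (auto simp: N_def)
  then have distr: "distr N lborel Z = density lborel (exponential_density 1)"
    by (simp add: distributed_def)
  have "(\<integral>\<^sup>+w. ennreal (indicator {0..<x} w * w ^ k / fact k) * g (real (Suc k) * ln (x / w)) \<partial>lborel) =
      (\<integral>\<^sup>+w. ennreal (x ^ Suc k / fact (Suc k)) * (ennreal (d w) * g (Z w)) \<partial>lborel)"
  proof (intro nn_integral_cong)
    fix w
    have "indicator {0..<x} w * w ^ k / fact k = x ^ Suc k / fact (Suc k) * d w"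
      using x by (simp add: d_def field_simps del: of_nat_Suc)
    moreover have "ennreal (x ^ Suc k / fact (Suc k) * d w) = ennreal (x ^ Suc k / fact (Suc k)) * ennreal (d w)"
      using x d_nonneg[of w] by (intro ennreal_mult) auto
    ultimately show "ennreal (indicator {0..<x} w * w ^ k / fact k) * g (real (Suc k) * ln (x / w)) =
        ennreal (x ^ Suc k / fact (Suc k)) * (ennreal (d w) * g (Z w))"
      by (simp only: Z_def mult.assoc)
  qed
  also have "\<dots> = ennreal (x ^ Suc k / fact (Suc k)) * (\<integral>\<^sup>+w. g (Z w) \<partial>N)"
    by (simp add: nn_integral_cmult N_def nn_integral_density)
  also have "(\<integral>\<^sup>+w. g (Z w) \<partial>N) = (\<integral>\<^sup>+t. g t \<partial>distr N lborel Z)"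
    by (subst nn_integral_distr) (auto simp: N_def)
  finally show ?thesis unfolding distr .
qed

lemma emeasure_exponential_greaterThan:
  assumes "0 \<le> a"
  shows "emeasure (density lborel (exponential_density 1)) {a<..} = ennreal (exp (- a))"
proof -
  let ?E = "density lborel (exponential_density 1)"
  interpret E: prob_space ?E by (rule prob_space_exponential_density) simp
  have "E.prob {..a} = 1 - exp (- a)"
    using emeasure_erlang_density[of 1 0 a] assms
    by (simp add: E.emeasure_eq_measure erlang_CDF_def)
  moreover have "{a<..} = space ?E - {..a}" by auto
  ultimately show ?thesis
    using E.prob_compl[of "{..a}"] by (simp add: E.emeasure_eq_measure)
qed

lemma emeasure_exponential_greaterThan_pos:
  "emeasure (density lborel (exponential_density 1)) {a<..} > 0"
proof -
  have "0 < emeasure (density lborel (exponential_density 1)) {max a 0<..}"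
    by (simp add: emeasure_exponential_greaterThan)
  also have "\<dots> \<le> emeasure (density lborel (exponential_density 1)) {a<..}"
    by (intro emeasure_mono) auto
  finally show ?thesis .
qed

text \<open>The tail exp (- w) cancels the exponential factor of the Erlang density, leaving the
  joint density exp (- x) w^k / k! on 0 \<le> w < x. Integrating over w first, by the power kernel,
  gives the next Erlang density in x and an independent exponential increment t. Note that
  \<open>erlang_density k 1\<close> has shape k + 1.\<close>

lemma nn_integral_erlang_step:
  fixes f :: "real \<Rightarrow> real \<Rightarrow> ennreal"
  assumes [measurable]: "case_prod f \<in> borel_measurable (borel \<Otimes>\<^sub>M borel)"
  defines "E \<equiv> density lborel (exponential_density 1)"
  shows "(\<integral>\<^sup>+w. (\<integral>\<^sup>+x. indicator {w<..} x * f (s + real (Suc k) * ln (x / w)) x \<partial>E) / emeasure E {w<..}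
      \<partial>density lborel (erlang_density k 1)) =
    (\<integral>\<^sup>+x. \<integral>\<^sup>+t. f (s + t) x \<partial>E \<partial>density lborel (erlang_density (Suc k) 1))"
proof -
  let ?L = "\<lambda>w x. ennreal (indicator {0..<x} w * w ^ k / fact k) * f (s + real (Suc k) * ln (x / w)) x"
  interpret E: prob_space E unfolding E_def by (rule prob_space_exponential_density) simp
  have sets_E [measurable_cong]: "sets E = sets borel" by (simp add: E_def)
  note measurable_emeasure_greaterThan[OF E.prob_space_axioms sets_E, measurable]
  have [measurable]: "(\<lambda>w. \<integral>\<^sup>+x. indicator {w<..} x * f (s + real (Suc k) * ln (x / w)) x \<partial>E) \<in> borel_measurable borel"
    unfolding indicator_def greaterThan_iff by measurable
  have "(\<integral>\<^sup>+w. (\<integral>\<^sup>+x. indicator {w<..} x * f (s + real (Suc k) * ln (x / w)) x \<partial>E) / emeasure E {w<..}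
      \<partial>density lborel (erlang_density k 1)) =
    (\<integral>\<^sup>+w. ennreal (erlang_density k 1 w) * ((\<integral>\<^sup>+x. indicator {w<..} x * f (s + real (Suc k) * ln (x / w)) x \<partial>E) / emeasure E {w<..}) \<partial>lborel)"
    by (subst nn_integral_density) (auto simp del: of_nat_Suc)
  also have "\<dots> = (\<integral>\<^sup>+w. \<integral>\<^sup>+x. ennreal (indicator {0<..} x * exp (- x)) * ?L w x \<partial>lborel \<partial>lborel)"
  proof (intro nn_integral_cong)
    fix w :: real
    let ?F = "\<lambda>x. indicator {w<..} x * f (s + real (Suc k) * ln (x / w)) x"
    show "ennreal (erlang_density k 1 w) * ((\<integral>\<^sup>+x. ?F x \<partial>E) / emeasure E {w<..}) =
        (\<integral>\<^sup>+x. ennreal (indicator {0<..} x * exp (- x)) * ?L w x \<partial>lborel)"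
    proof (cases "w < 0")
      case True
      then show ?thesis by (simp add: erlang_density_def)
    next
      case False
      have "ennreal (erlang_density k 1 w) * ((\<integral>\<^sup>+x. ?F x \<partial>E) / emeasure E {w<..}) =
          ennreal (w ^ k / fact k) * (\<integral>\<^sup>+x. ?F x \<partial>E)"
      proof -
        have "ennreal (erlang_density k 1 w) = ennreal (w ^ k / fact k) * ennreal (exp (- w))"
          using False by (simp add: erlang_density_def ennreal_mult[symmetric])
        moreover have "ennreal (exp (- w)) * (I / ennreal (exp (- w))) = I" for I
          by (simp add: ennreal_times_divide ennreal_mult_divide_eq mult.commute)
        ultimately show ?thesis
          using False by (simp add: E_def emeasure_exponential_greaterThan mult.assoc)
      qed
      also have "\<dots> = (\<integral>\<^sup>+x. ennreal (w ^ k / fact k) * (ennreal (exponential_density 1 x) * ?F x) \<partial>lborel)"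
        unfolding E_def by (subst nn_integral_density) (auto simp: nn_integral_cmult)
      also have "\<dots> = (\<integral>\<^sup>+x. ennreal (indicator {0<..} x * exp (- x)) * ?L w x \<partial>lborel)"
        using False
        by (intro nn_integral_cong)
           (auto simp: erlang_density_def mult_ac split: split_indicator)
      finally show ?thesis .
    qed
  qed
  also have "\<dots> = (\<integral>\<^sup>+x. \<integral>\<^sup>+w. ennreal (indicator {0<..} x * exp (- x)) * ?L w x \<partial>lborel \<partial>lborel)"
    by (intro lborel_pair.Fubini') (simp add: indicator_def, measurable)
  also have "\<dots> = (\<integral>\<^sup>+x. ennreal (erlang_density (Suc k) 1 x) * (\<integral>\<^sup>+t. f (s + t) x \<partial>E) \<partial>lborel)"
  proof (intro nn_integral_cong)
    fix x :: real
    show "(\<integral>\<^sup>+w. ennreal (indicator {0<..} x * exp (- x)) * ?L w x \<partial>lborel) =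
        ennreal (erlang_density (Suc k) 1 x) * (\<integral>\<^sup>+t. f (s + t) x \<partial>E)"
    proof (cases "x > 0")
      case True
      have "(\<integral>\<^sup>+w. ennreal (indicator {0<..} x * exp (- x)) * ?L w x \<partial>lborel) =
          ennreal (exp (- x)) * (\<integral>\<^sup>+w. ?L w x \<partial>lborel)"
        using True by (subst nn_integral_cmult) auto
      also have "(\<integral>\<^sup>+w. ?L w x \<partial>lborel) = ennreal (x ^ Suc k / fact (Suc k)) * (\<integral>\<^sup>+t. f (s + t) x \<partial>E)"
        unfolding E_def using True by (rule nn_integral_power_kernel) measurable
      also have "ennreal (exp (- x)) * (ennreal (x ^ Suc k / fact (Suc k)) * (\<integral>\<^sup>+t. f (s + t) x \<partial>E)) =
          ennreal (erlang_density (Suc k) 1 x) * (\<integral>\<^sup>+t. f (s + t) x \<partial>E)"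
        using True by (simp add: erlang_density_def ennreal_mult[symmetric] mult.assoc[symmetric] mult.commute del: power_Suc fact_Suc)
      finally show ?thesis .
    next
      case False
      then show ?thesis by (cases "x = 0") (auto simp: erlang_density_def)
    qed
  qed
  also have "\<dots> = (\<integral>\<^sup>+x. \<integral>\<^sup>+t. f (s + t) x \<partial>E \<partial>density lborel (erlang_density (Suc k) 1))"
    by (subst nn_integral_density) auto
  finally show ?thesis .
qed

section \<open>Joint law of the spacing sum and the record value\<close>

primrec spacing_law :: "nat \<Rightarrow> real measure" where
  "spacing_law 0 = return borel 0"
| "spacing_law (Suc k) = (spacing_law k \<star> density lborel (exponential_density 1))"

lemma sets_spacing_law [measurable_cong, simp]: "sets (spacing_law k) = sets borel"
  by (cases k) auto

lemma prob_space_spacing_law: "prob_space (spacing_law k)"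
proof (induction k)
  case 0
  show ?case by (simp add: prob_space_return)
next
  case (Suc k)
  interpret N: prob_space "spacing_law k" by fact
  interpret E: prob_space "density lborel (exponential_density 1)"
    by (rule prob_space_exponential_density) simp
  interpret pair_prob_space "spacing_law k" "density lborel (exponential_density 1)" ..
  show ?case by (simp add: convolution_def prob_space_distr)
qed

text \<open>\<open>spacing_law k\<close> is the Gamma law of shape k. At shape 0 it is a point mass
  without density, hence the recursion by convolution and the index shift here.\<close>

lemma spacing_law_Suc: "spacing_law (Suc k) = density lborel (erlang_density k 1)"
proof (induction k)
  case 0
  let ?E = "density lborel (exponential_density 1)"
  interpret E: prob_space ?E
    by (rule prob_space_exponential_density) simp
  have "return borel 0 \<star> ?E = ?E"
  proof (rule measure_eqI)
    fix A assume "A \<in> sets (return borel 0 \<star> ?E)"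
    then have [measurable]: "A \<in> sets borel" by simp
    show "emeasure (return borel 0 \<star> ?E) A = emeasure ?E A"
      by (subst convolution_emeasure)
         (auto simp: nn_integral_return prob_space_return prob_space.finite_measure E.finite_measure_axioms)
  qed simp
  then show ?case by simp
next
  case (Suc k)
  have "prob_space (density lborel (erlang_density k 1))" for k
    by (rule prob_space_erlang_density) simp
  then have fin: "finite_measure (density lborel (erlang_density k 1))" for k
    by (rule prob_space.finite_measure)
  have "spacing_law (Suc (Suc k)) = (spacing_law (Suc k) \<star> density lborel (exponential_density 1))"
    by (rule spacing_law.simps)
  also have "\<dots> = (density lborel (erlang_density k 1) \<star> density lborel (erlang_density 0 1))"
    by (simp only: Suc)
  also have "\<dots> = density lborel (erlang_density (Suc k) 1)"
    using convolution_erlang_density[of 1 k 0] by (subst convolution_density) (auto simp: fin)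
  finally show ?case .
qed

text \<open>Induction on \<open>k\<close>: the product form for \<open>k\<close> turns the Markov
  step into an iterated integral, the Erlang step acts on the record value for fixed s, and the new
  exponential increment is absorbed into the law of s by convolution.\<close>

lemma (in prob_space) distr_log_spacing_record_value:
  assumes indep: "indep_vars (\<lambda>_. borel) X UNIV"
    and exp: "\<And>j. distributed M lborel (X j) (exponential_density 1)"
  shows "distr M (borel \<Otimes>\<^sub>M borel)
      (\<lambda>\<omega>. (log_spacing (\<lambda>i. record_value X i \<omega>) k, record_value X k \<omega>)) =
    spacing_law k \<Otimes>\<^sub>M density lborel (erlang_density k 1)"
proof -
  let ?E = "density lborel (exponential_density 1)"
  have [measurable]: "X j \<in> borel_measurable M" for j
    using indep by (auto simp: indep_vars_def)
  have S [measurable]: "(\<lambda>\<omega>. log_spacing (\<lambda>i. record_value X i \<omega>) k) \<in> borel_measurable M" for k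
    unfolding log_spacing_def by measurable
  have distr: "distr M borel (X j) = ?E" for j
    using distributed_distr_eq_density[OF exp[of j]] by (simp cong: distr_cong)
  interpret E: prob_space ?E by (rule prob_space_exponential_density) simp
  show ?thesis
  proof (induction k)
    case 0
    have "distr M (borel \<Otimes>\<^sub>M borel) (\<lambda>\<omega>. (0, X 0 \<omega>)) = return borel (0 :: real) \<Otimes>\<^sub>M ?E"
    proof (rule measure_eqI)
      fix A :: "(real \<times> real) set"
      assume "A \<in> sets (distr M (borel \<Otimes>\<^sub>M borel) (\<lambda>\<omega>. (0, X 0 \<omega>)))"
      then have A [measurable]: "A \<in> sets (borel \<Otimes>\<^sub>M borel)" by simp
      have "emeasure (return borel 0 \<Otimes>\<^sub>M ?E) A = (\<integral>\<^sup>+x. emeasure ?E (Pair x -` A) \<partial>return borel 0)"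
        by (rule E.emeasure_pair_measure_alt) (simp cong: sets_pair_measure_cong)
      also have "\<dots> = emeasure ?E (Pair 0 -` A)"
        using E.measurable_emeasure_Pair[of A borel] by (simp add: nn_integral_return cong: sets_pair_measure_cong)
      also have "\<dots> = emeasure M {\<omega> \<in> space M. (0, X 0 \<omega>) \<in> A}"
        unfolding distr[of 0, symmetric] using sets_Pair1[OF A, of 0]
        by (subst emeasure_distr) (auto intro!: arg_cong[where f = "emeasure M"])
      also have "\<dots> = emeasure (distr M (borel \<Otimes>\<^sub>M borel) (\<lambda>\<omega>. (0, X 0 \<omega>))) A"
        by (subst emeasure_distr) (auto intro!: arg_cong[where f = "emeasure M"])
      finally show "emeasure (distr M (borel \<Otimes>\<^sub>M borel) (\<lambda>\<omega>. (0, X 0 \<omega>))) A =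
          emeasure (return borel 0 \<Otimes>\<^sub>M ?E) A" ..
    qed (simp cong: sets_pair_measure_cong)
    then show ?case by (simp add: record_value_def)
  next
    case (Suc k)
    let ?\<nu> = "spacing_law k" and ?\<mu> = "\<lambda>k. density lborel (erlang_density k 1)"
    let ?S = "\<lambda>k \<omega>. log_spacing (\<lambda>i. record_value X i \<omega>) k" and ?W = "record_value X"
    interpret \<nu>: prob_space ?\<nu> by (rule prob_space_spacing_law)
    interpret \<mu>: prob_space "?\<mu> m" for m by (rule prob_space_erlang_density) simp
    show ?case
    proof (rule measure_eqI)
      fix A assume "A \<in> sets (distr M (borel \<Otimes>\<^sub>M borel) (\<lambda>\<omega>. (?S (Suc k) \<omega>, ?W (Suc k) \<omega>)))"
      then have A [measurable]: "A \<in> sets (borel \<Otimes>\<^sub>M borel)" by simp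
      define f :: "real \<Rightarrow> real \<Rightarrow> ennreal" where "f s x = indicator A (s, x)" for s x
      have f [measurable]: "case_prod f \<in> borel_measurable (borel \<Otimes>\<^sub>M borel)"
        unfolding f_def by simp
      \<comment> \<open>\<open>\<Phi> s w\<close> is the conditional expectation of \<open>f\<close>
        at the next state, given the state (s, w) at record \<open>k\<close>.\<close>
      define \<Phi> where "\<Phi> s w = (\<integral>\<^sup>+x. indicator {w<..} x * f (s + real (Suc k) * ln (x / w)) x \<partial>?E) /
          emeasure ?E {w<..}" for s w
      note measurable_emeasure_greaterThan[OF E.prob_space_axioms, simplified, measurable]
      have \<Phi> [measurable]: "case_prod \<Phi> \<in> borel_measurable (borel \<Otimes>\<^sub>M borel)"
        unfolding \<Phi>_def indicator_def greaterThan_iff by measurable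
      have "emeasure (distr M (borel \<Otimes>\<^sub>M borel) (\<lambda>\<omega>. (?S (Suc k) \<omega>, ?W (Suc k) \<omega>))) A =
          (\<integral>\<^sup>+p. case_prod f p \<partial>distr M (borel \<Otimes>\<^sub>M borel) (\<lambda>\<omega>. (?S (Suc k) \<omega>, ?W (Suc k) \<omega>)))"
        by (subst nn_integral_indicator[symmetric]) (simp_all add: f_def split_beta' del: log_spacing_Suc)
      also have "\<dots> = (\<integral>\<^sup>+\<omega>. f (?S (Suc k) \<omega>) (?W (Suc k) \<omega>) \<partial>M)"
        using f by (subst nn_integral_distr) (auto simp del: log_spacing_Suc)
      also have "\<dots> = (\<integral>\<^sup>+\<omega>. f (?S k \<omega> + real (Suc k) * ln (?W (Suc k) \<omega> / ?W k \<omega>)) (?W (Suc k) \<omega>) \<partial>M)"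
        by simp
      also have "\<dots> = (\<integral>\<^sup>+\<omega>. \<Phi> (?S k \<omega>) (?W k \<omega>) \<partial>M)"
        unfolding \<Phi>_def
        by (rule nn_integral_next_record[OF indep distr emeasure_exponential_greaterThan_pos,
              where G = "\<lambda>s w x. f (s + real (Suc k) * ln (x / w)) x"]) measurable
      also have "\<dots> = (\<integral>\<^sup>+p. case_prod \<Phi> p \<partial>distr M (borel \<Otimes>\<^sub>M borel) (\<lambda>\<omega>. (?S k \<omega>, ?W k \<omega>)))"
        using \<Phi> by (subst nn_integral_distr) auto
      also have "\<dots> = (\<integral>\<^sup>+s. \<integral>\<^sup>+w. \<Phi> s w \<partial>?\<mu> k \<partial>?\<nu>)"
        unfolding Suc.IH by (subst \<mu>.nn_integral_fst[symmetric]) (auto cong: measurable_cong_sets sets_pair_measure_cong)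
      also have "\<dots> = (\<integral>\<^sup>+s. \<integral>\<^sup>+x. \<integral>\<^sup>+t. f (s + t) x \<partial>?E \<partial>?\<mu> (Suc k) \<partial>?\<nu>)"
        unfolding \<Phi>_def by (simp only: nn_integral_erlang_step[OF f])
      \<comment> \<open>The increment t must be integrated directly after s for the convolution
        formula to apply.\<close>
      also have "\<dots> = (\<integral>\<^sup>+s. \<integral>\<^sup>+t. \<integral>\<^sup>+x. f (s + t) x \<partial>?\<mu> (Suc k) \<partial>?E \<partial>?\<nu>)"
      proof (intro nn_integral_cong)
        fix s
        interpret pair_sigma_finite ?E "?\<mu> (Suc k)" ..
        show "(\<integral>\<^sup>+x. \<integral>\<^sup>+t. f (s + t) x \<partial>?E \<partial>?\<mu> (Suc k)) = (\<integral>\<^sup>+t. \<integral>\<^sup>+x. f (s + t) x \<partial>?\<mu> (Suc k) \<partial>?E)"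
          by (rule Fubini') measurable
      qed
      also have "\<dots> = (\<integral>\<^sup>+s. \<integral>\<^sup>+x. f s x \<partial>?\<mu> (Suc k) \<partial>spacing_law (Suc k))"
        unfolding spacing_law.simps
        by (rule nn_integral_convolution[symmetric])
           (auto simp: \<nu>.finite_measure_axioms E.finite_measure_axioms)
      also have "\<dots> = emeasure (spacing_law (Suc k) \<Otimes>\<^sub>M ?\<mu> (Suc k)) A"
        unfolding f_def by (rule \<mu>.emeasure_pair_measure[symmetric]) (simp cong: sets_pair_measure_cong)
      finally show "emeasure (distr M (borel \<Otimes>\<^sub>M borel) (\<lambda>\<omega>. (?S (Suc k) \<omega>, ?W (Suc k) \<omega>))) A =
          emeasure (spacing_law (Suc k) \<Otimes>\<^sub>M ?\<mu> (Suc k)) A" .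
    qed (simp cong: sets_pair_measure_cong)
  qed
qed

section \<open>Chi-square densities, null sets and product laws\<close>

lemma powr_less_iff:
  fixes x y b :: real
  assumes "0 < b" "0 \<le> x" "0 \<le> y"
  shows "x powr b < y powr b \<longleftrightarrow> x < y"
  using assms powr_less_mono2[of b] powr_mono2[of b y x] by (cases "x < y") auto

text \<open>Chi-square with 2(m + 1) degrees of freedom is the Gamma law of shape m + 1 and rate
  1/2. The origin is excluded because for m = 0 the Erlang density is 1/2 there, while
  \<open>chi_square_density\<close> is 0.\<close>

lemma chi_square_density_eq_erlang_density:
  assumes "x \<noteq> 0"
  shows "chi_square_density (2 * Suc m) x = erlang_density m (1 / 2) x"
proof (cases "x > 0")
  case True
  have "real (2 * Suc m) / 2 = real (Suc m)" "real (2 * Suc m) / 2 - 1 = real m"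
    by (simp_all add: field_simps)
  then have "chi_square_density (2 * Suc m) x =
      x powr real m * exp (- x / 2) / (2 powr real (Suc m) * Gamma (real (Suc m)))"
    using True by (simp only: chi_square_density_def if_True)
  also have "\<dots> = x ^ m * exp (- x / 2) / (2 ^ Suc m * fact m)"
    using True Gamma_fact[of m, where ?'a = real] powr_realpow[of 2 "Suc m"]
    by (simp add: powr_realpow)
  also have "\<dots> = erlang_density m (1 / 2) x"
    using True by (simp add: erlang_density_def power_divide)
  finally show ?thesis .
next
  case False
  with assms show ?thesis by (simp add: chi_square_density_def erlang_density_def)
qed

lemma distributed_chi_square_iff:
  "distributed M lborel X (\<lambda>x. ennreal (chi_square_density (2 * Suc m) x)) \<longleftrightarrow>
    distributed M lborel X (erlang_density m (1 / 2))"
proof (rule distributed_cong_density)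
  show "AE x in lborel. ennreal (chi_square_density (2 * Suc m) x) = ennreal (erlang_density m (1 / 2) x)"
    using AE_lborel_singleton[of "0::real"]
    by eventually_elim (rule arg_cong[OF chi_square_density_eq_erlang_density])
qed (auto simp: chi_square_density_def[abs_def])

text \<open>Needed because U and V are identified with functionals of exponential records only
  almost surely.\<close>

lemma distributed_cong_AE:
  assumes "distributed M N X f" and [measurable]: "Y \<in> measurable M N" and "AE x in M. X x = Y x"
  shows "distributed M N Y f"
proof -
  have [measurable]: "X \<in> measurable M N" using assms(1) by (rule distributed_measurable)
  have "distr M N Y = distr M N X"
    using assms(3) by (intro distr_cong_AE) auto
  then show ?thesis using assms(1) by (simp add: distributed_def)
qed

context prob_space
begin

lemma indep_var_cong_AE:
  assumes indep: "indep_var S X T Y"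
    and [measurable]: "X' \<in> measurable M S" "Y' \<in> measurable M T"
    and AE: "AE x in M. X x = X' x" "AE x in M. Y x = Y' x"
  shows "indep_var S X' T Y'"
proof -
  have [measurable]: "X \<in> measurable M S" "Y \<in> measurable M T"
    using indep_var_rv1[OF indep] indep_var_rv2[OF indep] by auto
  have "distr M S X' = distr M S X" "distr M T Y' = distr M T Y"
    using AE by (intro distr_cong_AE; auto)+
  moreover have "distr M (S \<Otimes>\<^sub>M T) (\<lambda>x. (X' x, Y' x)) = distr M (S \<Otimes>\<^sub>M T) (\<lambda>x. (X x, Y x))"
    using AE by (intro distr_cong_AE) auto
  ultimately show ?thesis
    using indep unfolding indep_var_distribution_eq by simp
qed

text \<open>Evaluating the joint law on rectangles with one side the whole space yields the
  marginals, as each factor has mass 1. Independence is then the product form itself.\<close>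

lemma indep_var_if_distr_pair:
  assumes [measurable]: "X \<in> measurable M S" "Y \<in> measurable M T"
    and joint: "distr M (S \<Otimes>\<^sub>M T) (\<lambda>\<omega>. (X \<omega>, Y \<omega>)) = \<mu> \<Otimes>\<^sub>M \<nu>"
    and \<mu>: "prob_space \<mu>" "sets \<mu> = sets S" and \<nu>: "prob_space \<nu>" "sets \<nu> = sets T"
  shows "distr M S X = \<mu>" and "distr M T Y = \<nu>" and "indep_var S X T Y"
proof -
  interpret \<mu>: prob_space \<mu> by fact
  interpret \<nu>: prob_space \<nu> by fact
  have emeasure: "emeasure M {\<omega> \<in> space M. X \<omega> \<in> A \<and> Y \<omega> \<in> B} = emeasure \<mu> A * emeasure \<nu> B"
    if [measurable]: "A \<in> sets S" "B \<in> sets T" for A B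
  proof -
    have "emeasure M {\<omega> \<in> space M. X \<omega> \<in> A \<and> Y \<omega> \<in> B} =
        emeasure (distr M (S \<Otimes>\<^sub>M T) (\<lambda>\<omega>. (X \<omega>, Y \<omega>))) (A \<times> B)"
      by (subst emeasure_distr) (auto intro!: arg_cong[where f = "emeasure M"])
    also have "\<dots> = emeasure \<mu> A * emeasure \<nu> B"
      unfolding joint using that \<mu>(2) \<nu>(2) by (intro \<nu>.emeasure_pair_measure_Times) auto
    finally show ?thesis .
  qed
  have space: "X \<omega> \<in> space S" "Y \<omega> \<in> space T" if "\<omega> \<in> space M" for \<omega>
    using that measurable_space[of X M S] measurable_space[of Y M T] by auto
  note space_eq = sets_eq_imp_space_eq[OF \<mu>(2)] sets_eq_imp_space_eq[OF \<nu>(2)]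
  show X: "distr M S X = \<mu>"
  proof (rule measure_eqI)
    fix A assume "A \<in> sets (distr M S X)"
    then have [measurable]: "A \<in> sets S" by simp
    have "emeasure (distr M S X) A = emeasure M {\<omega> \<in> space M. X \<omega> \<in> A \<and> Y \<omega> \<in> space T}"
      using space by (subst emeasure_distr) (auto intro!: arg_cong[where f = "emeasure M"])
    then show "emeasure (distr M S X) A = emeasure \<mu> A"
      using \<nu>.emeasure_space_1 by (simp add: emeasure space_eq)
  qed (simp add: \<mu>)
  show Y: "distr M T Y = \<nu>"
  proof (rule measure_eqI)
    fix B assume "B \<in> sets (distr M T Y)"
    then have [measurable]: "B \<in> sets T" by simp
    have "emeasure (distr M T Y) B = emeasure M {\<omega> \<in> space M. X \<omega> \<in> space S \<and> Y \<omega> \<in> B}"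
      using space by (subst emeasure_distr) (auto intro!: arg_cong[where f = "emeasure M"])
    then show "emeasure (distr M T Y) B = emeasure \<nu> B"
      using \<mu>.emeasure_space_1 by (simp add: emeasure space_eq)
  qed (simp add: \<nu>)
  show "indep_var S X T Y"
    unfolding indep_var_distribution_eq X Y joint by simp
qed

lemma exponential_records:
  fixes X :: "nat \<Rightarrow> 'a \<Rightarrow> real" and m :: nat
  assumes indep: "indep_vars (\<lambda>_. borel) X UNIV"
    and exp: "\<And>j. distributed M lborel (X j) (exponential_density 1)"
  defines "S \<equiv> \<lambda>\<omega>. log_spacing (\<lambda>i. record_value X i \<omega>) (Suc m)"
    and "W \<equiv> record_value X (Suc m)"
  shows "distributed M lborel S (erlang_density m 1)"
    and "distributed M lborel W (erlang_density (Suc m) 1)"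
    and "indep_var borel S borel W"
proof -
  have [measurable]: "X j \<in> borel_measurable M" for j
    using indep by (auto simp: indep_vars_def)
  have [measurable]: "S \<in> borel_measurable M" "W \<in> borel_measurable M"
    unfolding S_def W_def log_spacing_def by measurable
  have joint: "distr M (borel \<Otimes>\<^sub>M borel) (\<lambda>\<omega>. (S \<omega>, W \<omega>)) =
      density lborel (erlang_density m 1) \<Otimes>\<^sub>M density lborel (erlang_density (Suc m) 1)"
    unfolding S_def W_def
    using distr_log_spacing_record_value[OF indep exp, of "Suc m"] by (simp only: spacing_law_Suc)
  note laws = indep_var_if_distr_pair[OF _ _ joint prob_space_erlang_density _
      prob_space_erlang_density]
  show "distributed M lborel S (erlang_density m 1)"
    using laws(1) by (simp add: distributed_def cong: distr_cong)
  show "distributed M lborel W (erlang_density (Suc m) 1)"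
    using laws(2) by (simp add: distributed_def cong: distr_cong)
  show "indep_var borel S borel W"
    by (rule laws(3)) simp_all
qed

section \<open>Reduction of Weibull records to exponential records\<close>

lemma weibull_powr_exponential:
  assumes [measurable]: "X \<in> borel_measurable M"
    and cdf: "\<And>x. cdf (distr M borel X) x = weibull_cdf \<alpha> \<beta> x"
    and \<alpha>: "\<alpha> > 0" and \<beta>: "\<beta> > 0"
  shows "AE \<omega> in M. X \<omega> > 0"
    and "distributed M lborel (\<lambda>\<omega>. (X \<omega> / \<alpha>) powr \<beta>) (exponential_density 1)"
proof -
  have le: "emeasure M {\<omega> \<in> space M. X \<omega> \<le> c} = ennreal (weibull_cdf \<alpha> \<beta> c)" for c
  proof -
    have "{\<omega> \<in> space M. X \<omega> \<le> c} = X -` {..c} \<inter> space M" by auto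
    then show ?thesis
      unfolding cdf[symmetric] cdf_def by (simp add: measure_distr emeasure_eq_measure)
  qed
  show pos: "AE \<omega> in M. X \<omega> > 0"
    using le[of 0] by (intro AE_I[of _ _ "{\<omega> \<in> space M. X \<omega> \<le> 0}"]) (auto simp: weibull_cdf_def)
  show "distributed M lborel (\<lambda>\<omega>. (X \<omega> / \<alpha>) powr \<beta>) (exponential_density 1)"
  proof (rule exponential_distributedI)
    fix a :: real assume a: "0 \<le> a"
    \<comment> \<open>Inverting the increasing map x to (x / \<alpha>) powr \<beta> on the positive
      half-line turns the event into \<open>X \<omega> \<le> c\<close>, up to the null set where X
      is not positive.\<close>
    define c where "c = \<alpha> * a powr (1 / \<beta>)"
    have iff: "(x / \<alpha>) powr \<beta> \<le> a \<longleftrightarrow> x \<le> c" if "x > 0" for x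
    proof -
      have "(x / \<alpha>) powr \<beta> \<le> a \<longleftrightarrow> (x / \<alpha>) powr \<beta> \<le> (a powr (1 / \<beta>)) powr \<beta>"
        using a \<beta> by (simp add: powr_powr)
      also have "\<dots> \<longleftrightarrow> x / \<alpha> \<le> a powr (1 / \<beta>)"
        using that \<alpha> \<beta> unfolding not_less[symmetric] by (subst powr_less_iff) auto
      finally show ?thesis using \<alpha> by (simp add: c_def pos_divide_le_eq mult.commute)
    qed
    have "emeasure M {\<omega> \<in> space M. (X \<omega> / \<alpha>) powr \<beta> \<le> a} = emeasure M {\<omega> \<in> space M. X \<omega> \<le> c}"
    proof (rule emeasure_eq_AE)
      show "AE \<omega> in M. \<omega> \<in> {\<omega> \<in> space M. (X \<omega> / \<alpha>) powr \<beta> \<le> a} \<longleftrightarrow> \<omega> \<in> {\<omega> \<in> space M. X \<omega> \<le> c}"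
        using pos by eventually_elim (simp add: iff)
    qed measurable
    also have "\<dots> = ennreal (1 - exp (- a))"
    \<comment> \<open>For a = 0 also c = 0, which falls into the other branch of
      \<open>weibull_cdf\<close>; both sides are then 0.\<close>
    proof (cases "a = 0")
      case True
      then show ?thesis by (simp add: le c_def weibull_cdf_def)
    next
      case False
      then show ?thesis
        using a \<alpha> \<beta> by (simp add: le c_def weibull_cdf_def powr_powr)
    qed
    finally show "emeasure M {\<omega> \<in> space M. (X \<omega> / \<alpha>) powr \<beta> \<le> a} = 1 - ennreal (exp (- a * 1))"
      by (simp add: ennreal_minus flip: ennreal_1)
  qed simp_all
qed

end

text \<open>Record times depend only on comparisons between observations. Order is required to be
  preserved only at the sampled values, since the power map is increasing only on nonnegative
  arguments.\<close>

lemma record_value_strict_mono: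
  assumes "\<And>j k. g (X j \<omega>) < g (X k \<omega>) \<longleftrightarrow> X j \<omega> < X k \<omega>"
  shows "record_value (\<lambda>j \<omega>. g (X j \<omega>)) k \<omega> = g (record_value X k \<omega>)"
proof -
  have "record_time (\<lambda>j \<omega>. g (X j \<omega>)) k \<omega> = record_time X k \<omega>"
    by (induction k) (simp_all add: assms)
  then show ?thesis by (simp add: record_value_def)
qed

theorem theorem2p1:
  fixes M :: "'a measure"
    and X :: "nat \<Rightarrow> 'a \<Rightarrow> real"
    and R :: "nat \<Rightarrow> 'a \<Rightarrow> real"
    and U V :: "'a \<Rightarrow> real"
    and \<alpha> \<beta> :: real
    and n :: nat
  assumes "prob_space M"
    and "\<alpha> > 0" and "\<beta> > 0" and "n \<ge> 1"
    and "prob_space.indep_vars M (\<lambda>_. borel) X UNIV"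
    and "\<And>j x. cdf (distr M borel (X j)) x = weibull_cdf \<alpha> \<beta> x"
    and "R = record_value X"
    and "U = (\<lambda>\<omega>. 2 * \<beta> * (\<Sum>i=0..n. ln (R n \<omega> / R i \<omega>)))"
    and "V = (\<lambda>\<omega>. 2 * (R n \<omega> / \<alpha>) powr \<beta>)"
  shows "distributed M lborel U (\<lambda>x. ennreal (chi_square_density (2 * n) x))
       \<and> distributed M lborel V (\<lambda>x. ennreal (chi_square_density (2 * n + 2) x))
       \<and> prob_space.indep_var M borel U borel V"
proof -
  interpret prob_space M by fact
  note \<alpha> = assms(2) and \<beta> = assms(3) and indep = assms(5)
  \<comment> \<open>A successor is what gives \<open>S\<close> a density: for n = 0 it would be
    identically 0.\<close>
  obtain m where n: "n = Suc m" using assms(4) by (cases n) auto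
  have [measurable]: "X j \<in> borel_measurable M" for j
    using indep by (auto simp: indep_vars_def)
  have [measurable]: "U \<in> borel_measurable M" "V \<in> borel_measurable M"
    unfolding assms(7-9) by measurable
  define Y where "Y j \<omega> = (X j \<omega> / \<alpha>) powr \<beta>" for j \<omega>
  define S where "S = (\<lambda>\<omega>. log_spacing (\<lambda>i. record_value Y i \<omega>) n)"
  define W where "W = record_value Y n"
  have Y_indep: "indep_vars (\<lambda>_. borel) Y UNIV"
    unfolding Y_def[abs_def]
    using indep_vars_compose2[OF indep, of "\<lambda>_ x. (x / \<alpha>) powr \<beta>" "\<lambda>_. borel"] by simp
  have Y_exp: "distributed M lborel (Y j) (exponential_density 1)" for j
    unfolding Y_def[abs_def] by (rule weibull_powr_exponential[OF _ assms(6) \<alpha> \<beta>]) simp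
  note laws = exponential_records[OF Y_indep Y_exp, of m, folded n, folded S_def W_def]
  have "AE \<omega> in M. \<forall>j. X j \<omega> > 0"
    unfolding AE_all_countable by (intro allI weibull_powr_exponential[OF _ assms(6) \<alpha> \<beta>]) simp
  then have AE: "AE \<omega> in M. 2 * S \<omega> = U \<omega> \<and> 2 * W \<omega> = V \<omega>"
  proof eventually_elim
    case (elim \<omega>)
    have W: "record_value Y k \<omega> = (R k \<omega> / \<alpha>) powr \<beta>" for k
      unfolding Y_def[abs_def] assms(7)
      using elim \<alpha> \<beta>
      by (intro record_value_strict_mono) (simp add: powr_less_iff less_imp_le divide_less_cancel)
    have R: "R k \<omega> > 0" for k using elim by (simp add: assms(7) record_value_def)
    \<comment> \<open>The scale \<alpha> cancels in the ratio and the exponent \<beta> comes out of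
      the logarithm, which accounts for the factor \<beta> in U.\<close>
    have "ln (record_value Y n \<omega> / record_value Y i \<omega>) = \<beta> * ln (R n \<omega> / R i \<omega>)" for i
      using R[of n] R[of i] \<alpha> unfolding W
      by (simp add: ln_div ln_powr algebra_simps)
    moreover have "S \<omega> = (\<Sum>i=0..n. ln (record_value Y n \<omega> / record_value Y i \<omega>))"
      unfolding S_def using less_imp_neq[OF R] \<alpha> by (intro log_spacing_eq_sum) (auto simp: W)
    ultimately have "2 * S \<omega> = U \<omega>" by (simp add: assms(8) sum_distrib_left mult.assoc)
    moreover have "2 * W \<omega> = V \<omega>" by (simp add: W_def W assms(9))
    ultimately show ?case ..
  qed
  \<comment> \<open>Doubling changes the rate from 1 to 1/2, the rate of the chi-square
    laws.\<close>
  have "distributed M lborel (\<lambda>\<omega>. 2 * S \<omega>) (erlang_density m (1 / 2))"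
    and "distributed M lborel (\<lambda>\<omega>. 2 * W \<omega>) (erlang_density (Suc m) (1 / 2))"
    using erlang_distributed_mult_const[OF laws(1), of 2] erlang_distributed_mult_const[OF laws(2), of 2]
    by (simp_all add: n)
  then have "distributed M lborel U (erlang_density m (1 / 2))"
    and "distributed M lborel V (erlang_density (Suc m) (1 / 2))"
    using AE by (auto elim!: distributed_cong_AE)
  moreover have "indep_var borel (\<lambda>\<omega>. 2 * S \<omega>) borel (\<lambda>\<omega>. 2 * W \<omega>)"
    using indep_var_compose[OF laws(3), of "(*) 2" borel "(*) 2" borel] by (simp add: comp_def)
  then have "indep_var borel U borel V"
    using AE by (elim indep_var_cong_AE) auto
  ultimately show ?thesis
    using distributed_chi_square_iff[of M U m] distributed_chi_square_iff[of M V "Suc m"]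
    by (simp add: n)
qed

end
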